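(* Let $U$ be a non-empty open subset of $\mathbb{R}$ and let $k\in\mathbb{N}$. For every $f\in C^{k}(U)$ there is $g\in C^{\infty}(\mathbb{R})$ such that (i) $U\subseteq \operatorname{coz} g$, and (ii) the function $f\cdot g|_U$ on $U$ extends to a function $h\in C^{k}(\mathbb{R})$, i.e. there is $h\in C^{k}(\mathbb{R})$ with $f\cdot g|_U = h|_U$.
   Context: Here $\mathbb{N}=\{1,2,3,\dots\}$. For an open set $W\subseteq\mathbb{R}$ and $k\in\mathbb{N}$, $C^{k}(W)$ denotes the ring of real valued functions on $W$ whose derivatives up to and including the $k$-th exist and are continuous on $W$ (no boundedness of the function or of its derivatives is assumed), and $C^{\infty}(W)=\bigcap_{k\in\mathbb{N}}C^{k}(W)$. For $g\colon\mathbb{R}\to\mathbb{R}$ continuous, $\operatorname{coz} g=\{x\in\mathbb{R}\mid g(x)\neq 0\}$. *)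

theory Defs
  imports "HOL-Analysis.Analysis"
begin

text \<open>
  A function on an open set \<open>W\<close> is represented by a total function of which only the values on
  \<open>W\<close> matter. Since \<open>W\<close> is open, the derivatives at points of \<open>W\<close> do not depend on the values
  outside \<open>W\<close> (see \<open>Ck_cong\<close> below). The definitions are meant for open \<open>W\<close> only.
\<close>

definition Ck :: "nat \<Rightarrow> real set \<Rightarrow> (real \<Rightarrow> real) set" where
  "Ck k W = {f. (\<forall>j<k. \<forall>x\<in>W. (deriv ^^ j) f field_differentiable (at x)) \<and>
                (\<forall>j\<le>k. continuous_on W ((deriv ^^ j) f))}"

definition Cinf :: "real set \<Rightarrow> (real \<Rightarrow> real) set" where
  "Cinf W = (\<Inter>k\<in>{1..}. Ck k W)"

definition coz :: "(real \<Rightarrow> real) \<Rightarrow> real set" where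
  "coz g = {x. g x \<noteq> 0}"

lemma higher_deriv_cong_on_open:
  fixes f g :: "real \<Rightarrow> real"
  assumes "open W" and "\<And>x. x \<in> W \<Longrightarrow> f x = g x" and "x \<in> W"
  shows "(deriv ^^ j) f x = (deriv ^^ j) g x"
  using assms(3)
proof (induction j arbitrary: x)
  case 0
  then show ?case using assms(2) by simp
next
  case (Suc j)
  have "eventually (\<lambda>y. (deriv ^^ j) f y = (deriv ^^ j) g y) (nhds x)"
    using assms(1) Suc by (auto simp: eventually_nhds)
  then show ?case by (simp add: deriv_cong_ev)
qed

lemma Ck_cong:
  assumes "open W" and "\<And>x. x \<in> W \<Longrightarrow> f x = g x"
  shows "f \<in> Ck k W \<longleftrightarrow> g \<in> Ck k W"
proof -
  have *: "(deriv ^^ j) f x = (deriv ^^ j) g x" if "x \<in> W" for j x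
    using higher_deriv_cong_on_open[OF assms that] .
  have "(deriv ^^ j) f field_differentiable (at x) \<longleftrightarrow> (deriv ^^ j) g field_differentiable (at x)"
    if "x \<in> W" for j x
  proof -
    have "eventually (\<lambda>y. (deriv ^^ j) f y = (deriv ^^ j) g y) (nhds x)"
      using assms(1) that * by (auto simp: eventually_nhds)
    then show ?thesis
      unfolding field_differentiable_def by (intro ex_cong1 DERIV_cong_ev) auto
  qed
  moreover have "continuous_on W ((deriv ^^ j) f) \<longleftrightarrow> continuous_on W ((deriv ^^ j) g)" for j
    using * by (intro continuous_on_cong) auto
  ultimately show ?thesis by (simp add: Ck_def)
qed

end

theory Submission
  imports Defs
begin

text \<open>
  Cover \<open>U\<close> by countably many intervals \<open>(a n, b n)\<close> with \<open>[a n, b n] \<subseteq> U\<close>, and let \<open>\<phi> n\<close> be a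
  smooth function that is positive exactly on \<open>(a n, b n)\<close>. Then \<open>f * \<phi> n\<close>, extended by zero, is
  \<open>C\<^sup>k\<close> with compact support. For sufficiently small \<open>c n > 0\<close>, the series \<open>\<Sum>n. c n * \<phi> n\<close> and
  \<open>\<Sum>n. c n * (f * \<phi> n)\<close> converge uniformly with all relevant derivatives; these are \<open>g\<close> and \<open>h\<close>.
\<close>

section \<open>Closure properties of \<open>Ck\<close>\<close>

lemma Ck_0: "f \<in> Ck 0 W \<longleftrightarrow> continuous_on W f"
  by (simp add: Ck_def)

text \<open>Splitting off the innermost \<open>deriv\<close> instead of the outermost makes
  induction on \<open>k\<close> pass from \<open>f\<close> to \<open>deriv f\<close>, the form used
  in all later inductions.\<close>

lemma Ck_Suc:
  "f \<in> Ck (Suc k) W \<longleftrightarrow>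
    (\<forall>x\<in>W. f field_differentiable (at x)) \<and> continuous_on W f \<and> deriv f \<in> Ck k W"
proof -
  have "(deriv ^^ Suc j) f = (deriv ^^ j) (deriv f)" for j
    by (simp add: funpow_swap1)
  then show ?thesis
    unfolding Ck_def mem_Collect_eq less_Suc_eq_le[symmetric] All_less_Suc2[of "Suc k"]
      All_less_Suc2[of k "\<lambda>j. \<forall>x\<in>W. (deriv ^^ j) f field_differentiable (at x)"]
    by (simp del: funpow.simps(2)) blast
qed

lemma Ck_SucD:
  assumes "f \<in> Ck (Suc k) W"
  shows "\<And>x. x \<in> W \<Longrightarrow> (f has_real_derivative deriv f x) (at x)" and "deriv f \<in> Ck k W"
  using assms by (simp_all add: Ck_Suc DERIV_deriv_iff_field_differentiable)

lemma Ck_SucI: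
  assumes "open W" and D: "\<And>x. x \<in> W \<Longrightarrow> (f has_real_derivative f' x) (at x)" and "f' \<in> Ck k W"
  shows "f \<in> Ck (Suc k) W"
proof -
  have "deriv f \<in> Ck k W"
    using Ck_cong[OF assms(1), of "deriv f" f'] DERIV_imp_deriv[OF D] assms(3) by simp
  moreover have "f field_differentiable (at x)" if "x \<in> W" for x
    using D[OF that] by (auto simp: field_differentiable_def)
  moreover have "continuous_on W f"
    using D by (meson DERIV_isCont continuous_at_imp_continuous_on)
  ultimately show ?thesis
    by (simp add: Ck_Suc)
qed

lemma Ck_mono: "j \<le> k \<Longrightarrow> f \<in> Ck k W \<Longrightarrow> f \<in> Ck j W"
  by (simp add: Ck_def)

lemma Ck_add:
  assumes "open W" and "f \<in> Ck k W" and "g \<in> Ck k W"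
  shows "(\<lambda>x. f x + g x) \<in> Ck k W"
  using assms(2,3)
proof (induction k arbitrary: f g)
  case 0
  then show ?case by (auto simp: Ck_0 intro: continuous_intros)
next
  case (Suc k)
  show ?case
    using Suc.IH[OF Suc.prems[THEN Ck_SucD(2)]] Suc.prems[THEN Ck_SucD(1)]
    by (intro Ck_SucI[OF assms(1) DERIV_add])
qed

lemma Ck_mult:
  assumes "open W" and "f \<in> Ck k W" and "g \<in> Ck k W"
  shows "(\<lambda>x. f x * g x) \<in> Ck k W"
  using assms(2,3)
proof (induction k arbitrary: f g)
  case 0
  then show ?case by (auto simp: Ck_0 intro: continuous_intros)
next
  case (Suc k)
  \<comment> \<open>The product rule pairs each derivative with an undifferentiated factor, so the
    induction hypothesis also needs \<open>f\<close> and \<open>g\<close> themselves one order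
    lower.\<close>
  have "f \<in> Ck k W" "g \<in> Ck k W"
    using Suc.prems by (auto intro: Ck_mono[of k "Suc k"])
  then have "(\<lambda>x. deriv f x * g x + f x * deriv g x) \<in> Ck k W"
    using Suc by (intro Ck_add[OF assms(1)]) (auto dest: Ck_SucD)
  then show ?case
    using Suc.prems[THEN Ck_SucD(1)]
    by (intro Ck_SucI[OF assms(1) DERIV_mult']) (simp_all add: add.commute)
qed

lemma higher_deriv_const: "(deriv ^^ j) (\<lambda>x. c::real) = (\<lambda>x. if j = 0 then c else 0)"
  by (induction j) auto

lemma Ck_const: "(\<lambda>x. c) \<in> Ck k W"
  by (auto simp: Ck_def higher_deriv_const)

lemma higher_deriv_cmult_Ck:
  assumes "open W" and "f \<in> Ck k W" and "j \<le> k" and "x \<in> W"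
  shows "(deriv ^^ j) (\<lambda>x. c * f x) x = c * (deriv ^^ j) f x"
  using assms(2-4)
proof (induction j arbitrary: f k x)
  case 0
  then show ?case by simp
next
  case (Suc j)
  then obtain m where m: "k = Suc m" "j \<le> m"
    by (cases k) auto
  note f = Ck_SucD[OF Suc.prems(1)[unfolded m]]
  have "(deriv ^^ Suc j) (\<lambda>x. c * f x) x = (deriv ^^ j) (deriv (\<lambda>x. c * f x)) x"
    by (simp add: funpow_swap1)
  also have "\<dots> = (deriv ^^ j) (\<lambda>x. c * deriv f x) x"
    using Suc.prems(3) f(1)
    by (intro higher_deriv_cong_on_open[OF assms(1)]) (auto intro!: DERIV_imp_deriv DERIV_cmult)
  also have "\<dots> = c * (deriv ^^ j) (deriv f) x"
    using Suc.IH[OF f(2) m(2) Suc.prems(3)] .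
  also have "\<dots> = c * (deriv ^^ Suc j) f x"
    by (simp add: funpow_swap1)
  finally show ?case .
qed

lemma Ck_Un:
  assumes "open V" and "open W" and "f \<in> Ck k V" and "f \<in> Ck k W"
  shows "f \<in> Ck k (V \<union> W)"
  using assms unfolding Ck_def by (auto intro: continuous_on_open_Un)

text \<open>The function is a product of \<open>Ck\<close> functions on \<open>U\<close> and
  vanishes on \<open>- K\<close>; these two open sets cover the line because \<open>K\<close> lies
  inside \<open>U\<close>.\<close>

lemma Ck_extend_by_zero:
  assumes "open U" and "closed K" and "K \<subseteq> U" and "f \<in> Ck k U" and "\<phi> \<in> Ck k UNIV"
    and zero: "\<And>x. x \<notin> K \<Longrightarrow> \<phi> x = 0"
  shows "(\<lambda>x. if x \<in> U then f x * \<phi> x else 0) \<in> Ck k UNIV" (is "?h \<in> _")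
proof -
  have "\<phi> \<in> Ck k U"
    using assms(5) by (auto simp: Ck_def intro: continuous_on_subset)
  then have "?h \<in> Ck k U"
    using Ck_cong[OF assms(1), of ?h "\<lambda>x. f x * \<phi> x" k] Ck_mult[OF assms(1,4)] by simp
  moreover have "?h \<in> Ck k (- K)"
    using Ck_cong[of "- K" ?h "\<lambda>x. 0" k] Ck_const[of 0 k "- K"] open_Compl[OF assms(2)] zero
    by (simp cong: if_cong)
  ultimately have "?h \<in> Ck k (U \<union> - K)"
    using assms(1,2) by (intro Ck_Un) auto
  moreover have "U \<union> - K = UNIV"
    using assms(3) by auto
  ultimately show ?thesis by simp
qed

text \<open>Each derivative is continuous on the compact \<open>K\<close> and vanishes on the open
  complement, where \<open>f\<close> is locally zero.\<close>

lemma Ck_compact_support_bounded: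
  assumes "compact K" and f: "f \<in> Ck k UNIV" and zero: "\<And>x. x \<notin> K \<Longrightarrow> f x = 0"
  shows "\<exists>B. \<forall>j\<le>k. \<forall>x. \<bar>(deriv ^^ j) f x\<bar> \<le> B"
proof -
  have "\<exists>B. \<forall>x. \<bar>(deriv ^^ j) f x\<bar> \<le> B" if "j \<le> k" for j
  proof -
    have "continuous_on K ((deriv ^^ j) f)"
      using f that by (auto simp: Ck_def intro: continuous_on_subset)
    then have "bounded ((deriv ^^ j) f ` K)"
      using assms(1) compact_continuous_image compact_imp_bounded by blast
    then obtain B where B: "0 < B" "\<And>x. x \<in> K \<Longrightarrow> \<bar>(deriv ^^ j) f x\<bar> \<le> B"
      unfolding bounded_pos by auto
    have "open (- K)"
      using assms(1) by (simp add: compact_imp_closed open_Compl)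
    then have "(deriv ^^ j) f x = 0" if "x \<notin> K" for x
      using higher_deriv_cong_on_open[of "- K" f "\<lambda>x. 0" x j] zero that
      by (simp add: higher_deriv_const)
    then show ?thesis
      using B by (intro exI[of _ B]) force
  qed
  then obtain B where B: "\<And>j x. j \<le> k \<Longrightarrow> \<bar>(deriv ^^ j) f x\<bar> \<le> B j"
    by metis
  have "\<bar>(deriv ^^ j) f x\<bar> \<le> (\<Sum>i\<le>k. B i)" if "j \<le> k" for j x
  proof -
    have "0 \<le> B i" if "i \<le> k" for i
      using B[OF that, of x] by linarith
    then have "B j \<le> (\<Sum>i\<le>k. B i)"
      using that by (intro member_le_sum) auto
    then show ?thesis
      using B[OF that, of x] by linarith
  qed
  then show ?thesis by blast
qed

text \<open>Termwise differentiation by the Weierstrass M-test. The bound is required only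
  eventually, with a threshold that may depend on \<open>j\<close>; hence one sequence
  \<open>M\<close> can serve every order of differentiation.\<close>

lemma Ck_suminf:
  assumes "summable M" and "\<And>n. u n \<in> Ck k UNIV"
    and "\<And>j. j \<le> k \<Longrightarrow> \<forall>\<^sub>F n in sequentially. \<forall>x. \<bar>(deriv ^^ j) (u n) x\<bar> \<le> M n"
  shows "(\<lambda>x. \<Sum>n. u n x) \<in> Ck k UNIV"
  using assms(2,3)
proof (induction k arbitrary: u)
  case 0
  have "uniform_limit UNIV (\<lambda>n x. \<Sum>i<n. u i x) (\<lambda>x. \<Sum>n. u n x) sequentially"
    using 0(2)[of 0] assms(1) by (intro Weierstrass_m_test_ev) auto
  then show ?case
    using 0(1) unfolding Ck_0
    by (intro uniform_limit_theorem) (auto intro!: always_eventually continuous_on_sum)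
next
  case (Suc k)
  note u = Ck_SucD[OF Suc.prems(1)]
  have bound: "\<forall>\<^sub>F n in sequentially. \<forall>x. \<bar>(deriv ^^ j) (deriv (u n)) x\<bar> \<le> M n" if "j \<le> k" for j
    using Suc.prems(2)[of "Suc j"] that by (simp add: funpow_swap1)
  have "uniformly_convergent_on UNIV (\<lambda>n x. \<Sum>i<n. deriv (u i) x)"
    using Weierstrass_m_test_ev[OF _ assms(1), of UNIV "\<lambda>n. deriv (u n)"] bound[of 0]
    by (auto simp: uniformly_convergent_on_def)
  \<comment> \<open>Differentiating the series termwise needs convergence at one base point, here
    0.\<close>
  moreover have "summable (\<lambda>n. u n 0)"
    using Suc.prems(2)[of 0]
    by (intro summable_comparison_test_ev[OF _ assms(1)]) (auto elim: eventually_mono)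
  ultimately have D: "((\<lambda>x. \<Sum>n. u n x) has_real_derivative (\<Sum>n. deriv (u n) x)) (at x)" for x
    using u(1) by (intro has_field_derivative_series'(2)[of UNIV _ _ 0]) auto
  have "(\<lambda>x. \<Sum>n. deriv (u n) x) \<in> Ck k UNIV"
    using u(2) bound by (intro Suc.IH) auto
  then show ?case
    using D by (intro Ck_SucI) auto
qed

section \<open>Smooth bump functions\<close>

text \<open>
  The functions \<open>x \<mapsto> p(1/x) exp(-1/x)\<close>, extended by zero to \<open>x \<le> 0\<close>, are closed under
  differentiation, which gives smoothness without computing the higher derivatives.
\<close>

definition flat_exp :: "real poly \<Rightarrow> real \<Rightarrow> real" where
  "flat_exp p x = (if x > 0 then poly p (1 / x) * exp (- (1 / x)) else 0)"

lemma poly_times_exp_minus_tendsto_0: "((\<lambda>x. poly p x * exp (- x)) \<longlongrightarrow> (0::real)) at_top"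
proof -
  have "((\<lambda>x. \<Sum>i\<le>degree p. coeff p i * (x ^ i / exp x)) \<longlongrightarrow> (\<Sum>i\<le>degree p. coeff p i * 0)) at_top"
    by (intro tendsto_intros tendsto_power_div_exp_0)
  then show ?thesis
    by (simp add: poly_altdef exp_minus sum_distrib_right divide_inverse mult.assoc)
qed

text \<open>With t = 1/x one has dt/dx = -t^2, so p(t) exp(-t) has x-derivative t^2 (p(t) - p'(t))
  exp(-t), again of the same shape. At 0 the difference quotient tends to 0 from both sides.\<close>

lemma flat_exp_has_derivative:
  "(flat_exp p has_real_derivative flat_exp (monom 1 2 * (p - pderiv p)) x) (at x)"
proof -
  consider "x > 0" | "x < 0" | "x = 0" by linarith
  then show ?thesis
  proof cases
    case 1
    have inv: "((\<lambda>x. 1 / x) has_real_derivative - (1 / x)\<^sup>2) (at x)"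
      using 1 by (auto intro!: derivative_eq_intros simp: power2_eq_square)
    have "((\<lambda>x. poly p (1 / x) * exp (- (1 / x))) has_real_derivative
        poly (pderiv p) (1 / x) * - (1 / x)\<^sup>2 * exp (- (1 / x)) +
        exp (- (1 / x)) * - (- (1 / x)\<^sup>2) * poly p (1 / x)) (at x)"
      by (intro DERIV_mult DERIV_chain2[OF poly_DERIV] DERIV_chain2[OF DERIV_exp] DERIV_minus inv)
    also have "poly (pderiv p) (1 / x) * - (1 / x)\<^sup>2 * exp (- (1 / x)) +
        exp (- (1 / x)) * - (- (1 / x)\<^sup>2) * poly p (1 / x) =
        flat_exp (monom 1 2 * (p - pderiv p)) x"
      using 1 by (simp add: flat_exp_def poly_monom algebra_simps)
    finally have "((\<lambda>x. poly p (1 / x) * exp (- (1 / x))) has_real_derivative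
        flat_exp (monom 1 2 * (p - pderiv p)) x) (at x)" .
    then show ?thesis
      by (rule has_field_derivative_transform_within_open[where S = "{0<..}"])
        (use 1 in \<open>auto simp: flat_exp_def\<close>)
  next
    case 2
    have "((\<lambda>x. 0) has_real_derivative flat_exp (monom 1 2 * (p - pderiv p)) x) (at x)"
      using 2 by (simp add: flat_exp_def)
    then show ?thesis
      by (rule has_field_derivative_transform_within_open[where S = "{..<0}"])
        (use 2 in \<open>auto simp: flat_exp_def\<close>)
  next
    case 3
    \<comment> \<open>Dividing by x multiplies by t = 1/x, so for x > 0 the difference quotient is
      the same expression with \<open>pCons 0 p\<close>, the polynomial t p(t).\<close>
    have "((\<lambda>x. poly (pCons 0 p) (inverse x) * exp (- inverse x)) \<longlongrightarrow> 0) (at_right 0)"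
      using filterlim_compose[OF poly_times_exp_minus_tendsto_0 filterlim_inverse_at_top_right] .
    then have "((\<lambda>x. flat_exp p x / x) \<longlongrightarrow> 0) (at_right 0)"
      by (rule Lim_transform_eventually)
        (auto simp: flat_exp_def eventually_at_filter divide_inverse)
    moreover have "((\<lambda>x. flat_exp p x / x) \<longlongrightarrow> 0) (at_left 0)"
      by (rule Lim_transform_eventually[OF tendsto_const])
        (auto simp: flat_exp_def eventually_at_filter)
    ultimately have "((\<lambda>x. flat_exp p x / x) \<longlongrightarrow> 0) (at 0)"
      by (rule filterlim_split_at[rotated])
    then show ?thesis
      using 3 by (simp add: has_field_derivative_iff flat_exp_def)
  qed
qed

text \<open>The affine argument covers both \<open>x - a\<close> and \<open>b - x\<close> without a
  chain rule for \<open>Ck\<close>: the inner derivative \<open>c\<close> is absorbed into the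
  polynomial, and the induction runs over all \<open>p\<close>.\<close>

lemma flat_exp_affine_Ck: "(\<lambda>x. flat_exp p (c * x + d)) \<in> Ck k UNIV"
proof (induction k arbitrary: p)
  case 0
  have "continuous_on UNIV (flat_exp p)"
    using DERIV_isCont[OF flat_exp_has_derivative] by (simp add: continuous_on_eq_continuous_at)
  then show ?case
    unfolding Ck_0 by (rule continuous_on_compose2) (auto intro!: continuous_intros)
next
  case (Suc k)
  have affine: "((\<lambda>x. c * x + d) has_real_derivative c) (at x)" for x
    by (auto intro!: derivative_eq_intros)
  have "flat_exp q y * c = flat_exp (smult c q) y" for q y
    by (simp add: flat_exp_def)
  then have "((\<lambda>x. flat_exp p (c * x + d)) has_real_derivative
      flat_exp (smult c (monom 1 2 * (p - pderiv p))) (c * x + d)) (at x)" for x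
    using DERIV_chain2[OF flat_exp_has_derivative affine] by metis
  then show ?case
    using Suc.IH by (intro Ck_SucI) auto
qed

text \<open>Here \<open>1\<close> is the constant polynomial, so each factor is the classical
  exp(-1/x), cut off to zero for x <= 0.\<close>

definition bump :: "real \<Rightarrow> real \<Rightarrow> real \<Rightarrow> real" where
  "bump a b x = flat_exp 1 (x - a) * flat_exp 1 (b - x)"

lemma bump_Ck: "bump a b \<in> Ck k UNIV"
  using Ck_mult[OF open_UNIV flat_exp_affine_Ck[of 1 1 "-a" k] flat_exp_affine_Ck[of 1 "-1" b k]]
  unfolding bump_def by simp

lemma bump_nonneg: "0 \<le> bump a b x"
  by (simp add: bump_def flat_exp_def)

lemma bump_pos_iff: "0 < bump a b x \<longleftrightarrow> a < x \<and> x < b"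
  by (simp add: bump_def flat_exp_def)

lemma bump_eq_0: "x \<notin> {a..b} \<Longrightarrow> bump a b x = 0"
  by (auto simp: bump_def flat_exp_def)

section \<open>Extension after multiplication by a smooth function\<close>

lemma open_countable_interval_cover:
  fixes U :: "real set"
  assumes "open U" and "U \<noteq> {}"
  obtains a b :: "nat \<Rightarrow> real"
  where "\<And>n. {a n..b n} \<subseteq> U" and "\<And>x. x \<in> U \<Longrightarrow> \<exists>n. a n < x \<and> x < b n"
proof -
  \<comment> \<open>Rational endpoints make the family countable. Pairs with
    \<open>fst p > snd p\<close> qualify as empty intervals; their bumps vanish identically.\<close>
  define A where "A = {p \<in> \<rat> \<times> \<rat>. {fst p..snd p} \<subseteq> U}"
  have cover: "\<exists>p\<in>A. fst p < x \<and> x < snd p" if "x \<in> U" for x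
  proof -
    obtain e where e: "e > 0" "cball x e \<subseteq> U"
      using assms(1) \<open>x \<in> U\<close> open_contains_cball by blast
    obtain q r where "q \<in> \<rat>" "x - e < q" "q < x" "r \<in> \<rat>" "x < r" "r < x + e"
      using Rats_dense_in_real[of "x - e" x] Rats_dense_in_real[of x "x + e"] e(1) by auto
    moreover from this have "{q..r} \<subseteq> U"
      using e(2) by (force simp: cball_eq_atLeastAtMost)
    ultimately show ?thesis
      by (intro bexI[of _ "(q, r)"]) (auto simp: A_def)
  qed
  then have "A \<noteq> {}"
    using assms(2) by blast
  moreover have "countable A"
    unfolding A_def by (rule countable_subset[of _ "\<rat> \<times> \<rat>"]) (auto simp: countable_rat)
  ultimately have A: "range (from_nat_into A) = A"
    by (rule range_from_nat_into)
  show ?thesis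
  proof (rule that)
    show "{fst (from_nat_into A n)..snd (from_nat_into A n)} \<subseteq> U" for n
      using from_nat_into[OF \<open>A \<noteq> {}\<close>] unfolding A_def by blast
    show "\<exists>n. fst (from_nat_into A n) < x \<and> x < snd (from_nat_into A n)" if "x \<in> U" for x
      using cover[OF that] A by (metis imageE)
  qed
qed

theorem theorem2p2:
  fixes U :: "real set" and k :: nat and f :: "real \<Rightarrow> real"
  assumes "open U" and "U \<noteq> {}" and "k \<ge> 1" and "f \<in> Ck k U"
  shows "\<exists>g \<in> Cinf UNIV. U \<subseteq> coz g \<and> (\<exists>h \<in> Ck k UNIV. \<forall>x\<in>U. f x * g x = h x)"
proof -
  obtain a b :: "nat \<Rightarrow> real" where ab: "\<And>n. {a n..b n} \<subseteq> U"
    and cover: "\<And>x. x \<in> U \<Longrightarrow> \<exists>n. a n < x \<and> x < b n"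
    using open_countable_interval_cover[OF assms(1,2)] by blast
  define \<phi> where "\<phi> n = bump (a n) (b n)" for n
  define \<psi> where "\<psi> n = (\<lambda>x. if x \<in> U then f x * \<phi> n x else 0)" for n
  have \<phi>: "\<phi> n \<in> Ck m UNIV" for n m
    by (simp add: \<phi>_def bump_Ck)
  have \<phi>_0: "\<phi> n x = 0" if "x \<notin> {a n..b n}" for n x
    unfolding \<phi>_def using that by (rule bump_eq_0)
  have \<psi>: "\<psi> n \<in> Ck k UNIV" for n
    unfolding \<psi>_def by (rule Ck_extend_by_zero[OF assms(1) _ ab assms(4) \<phi> \<phi>_0]) auto
  have \<psi>_0: "\<psi> n x = 0" if "x \<notin> {a n..b n}" for n x
    using \<phi>_0[OF that] by (simp add: \<psi>_def)
  \<comment> \<open>Diagonal choice: \<open>A n\<close> bounds only the orders up to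
    \<open>n\<close>. For a fixed order \<open>j\<close> this covers all but finitely many terms,
    which suffices for \<open>g\<close> to be smooth.\<close>
  have "\<exists>A. \<forall>j\<le>n. \<forall>x. \<bar>(deriv ^^ j) (\<phi> n) x\<bar> \<le> A" for n
    using \<phi> \<phi>_0 by (intro Ck_compact_support_bounded[of "{a n..b n}"]) auto
  then obtain A where A: "\<And>n j x. j \<le> n \<Longrightarrow> \<bar>(deriv ^^ j) (\<phi> n) x\<bar> \<le> A n"
    by metis
  have "\<exists>B. \<forall>j\<le>k. \<forall>x. \<bar>(deriv ^^ j) (\<psi> n) x\<bar> \<le> B" for n
    using \<psi> \<psi>_0 by (intro Ck_compact_support_bounded[of "{a n..b n}"]) auto
  then obtain B where B: "\<And>n j x. j \<le> k \<Longrightarrow> \<bar>(deriv ^^ j) (\<psi> n) x\<bar> \<le> B n"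
    by metis
  \<comment> \<open>The denominator is positive and dominates both bounds whatever their signs, so
    one geometric series majorizes the differentiated terms of \<open>g\<close> and of
    \<open>h\<close>.\<close>
  define c where "c n = (1 / 2) ^ n / (1 + \<bar>A n\<bar> + \<bar>B n\<bar>)" for n
  have c_pos: "c n > 0" for n
    by (simp add: c_def add_pos_nonneg)
  have small: "\<bar>c n * y\<bar> \<le> (1 / 2) ^ n" if "\<bar>y\<bar> \<le> A n \<or> \<bar>y\<bar> \<le> B n" for n y
  proof -
    have "\<bar>c n * y\<bar> \<le> c n * (1 + \<bar>A n\<bar> + \<bar>B n\<bar>)"
      using that c_pos[of n] by (auto simp: abs_mult)
    also have "\<dots> = (1 / 2) ^ n"
      by (simp add: c_def add_pos_nonneg order_less_imp_not_eq2)
    finally show ?thesis .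
  qed
  have geom: "summable (\<lambda>n. (1 / 2 :: real) ^ n)"
    by (simp add: summable_geometric)
  have scaled_Ck: "(\<lambda>x. c n * u x) \<in> Ck m UNIV" if "u \<in> Ck m UNIV" for u n m
    using that by (intro Ck_mult Ck_const) auto
  define g where "g x = (\<Sum>n. c n * \<phi> n x)" for x
  define h where "h x = (\<Sum>n. c n * \<psi> n x)" for x
  have "g \<in> Ck m UNIV" for m
    unfolding g_def
  proof (rule Ck_suminf[OF geom])
    \<comment> \<open>The bound \<open>A n\<close> applies to order \<open>j\<close> once
      \<open>n\<close> is at least \<open>j\<close>.\<close>
    show "\<forall>\<^sub>F n in sequentially. \<forall>x. \<bar>(deriv ^^ j) (\<lambda>x. c n * \<phi> n x) x\<bar> \<le> (1 / 2) ^ n" for j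
      using eventually_ge_at_top[of j]
      by eventually_elim
        (simp add: higher_deriv_cmult_Ck[OF open_UNIV \<phi> order_refl] small A)
  qed (intro scaled_Ck \<phi>)
  then have g: "g \<in> Cinf UNIV"
    by (simp add: Cinf_def)
  have h: "h \<in> Ck k UNIV"
    unfolding h_def
  proof (rule Ck_suminf[OF geom])
    show "\<forall>\<^sub>F n in sequentially. \<forall>x. \<bar>(deriv ^^ j) (\<lambda>x. c n * \<psi> n x) x\<bar> \<le> (1 / 2) ^ n"
      if "j \<le> k" for j
      using that by (simp add: higher_deriv_cmult_Ck[OF open_UNIV \<psi>] small B)
  qed (intro scaled_Ck \<psi>)
  \<comment> \<open>Order 0 is covered by \<open>A n\<close> for every \<open>n\<close>, so no
    initial terms have to be skipped.\<close>
  have sum: "summable (\<lambda>n. c n * \<phi> n x)" for x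
    using small A[of 0] by (intro summable_comparison_test'[OF geom, of 0]) auto
  have "g x > 0" if x: "x \<in> U" for x
  proof -
    obtain n where "a n < x" "x < b n"
      using cover[OF x] by blast
    then have "0 < c n * \<phi> n x"
      using c_pos by (simp add: \<phi>_def bump_pos_iff)
    moreover have "0 \<le> c i * \<phi> i x" for i
      using c_pos[of i] by (simp add: \<phi>_def bump_nonneg)
    ultimately show ?thesis
      unfolding g_def by (intro suminf_pos2[OF sum])
  qed
  then have "U \<subseteq> coz g"
    by (auto simp: coz_def order_less_imp_not_eq2)
  \<comment> \<open>On \<open>U\<close> the terms satisfy
    \<open>\<psi> n x = f x * \<phi> n x\<close>, so the factor \<open>f x\<close> can be moved into
    the convergent series.\<close>
  moreover have "f x * g x = h x" if "x \<in> U" for x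
    using suminf_mult[OF sum, of "f x" x] that
    by (simp add: g_def h_def \<psi>_def mult.left_commute)
  ultimately show ?thesis
    using g h by blast
qed

end
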